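(* Let $n\ge1$, $\mathfrak g=\mathfrak{sl}(n,\mathbb C)$, and let $\mathbf S$ be the spin module associated with the Cartan subalgebra $\mathfrak h=\mathfrak t$ of diagonal matrices. The map $\lambda\mapsto\mu[\lambda]$ establishes a bijection between the set of partitions $\mathcal P(n)$ and the set $\Lambda^+(\mathbf S)$ of dominant weights of the spin module.
   Context: $\epsilon_i\in\mathfrak t^*$ is the functional $\mathrm{diag}(t_1,\ldots,t_n)\mapsto t_i$, $\Phi^+=\{\epsilon_i-\epsilon_j:1\le i<j\le n\}$, $\varpi_i=\epsilon_1+\cdots+\epsilon_i$ ($1\le i\le n-1$). A weight $\sum_{i=1}^{n-1}x_i\varpi_i$ is dominant if $x_i\ge0$ for all $i$. The spin module for $\mathfrak h=\mathfrak t$ is $\mathbf S=\bigwedge\mathfrak u^+$ with $\mathfrak u^+=\bigoplus_{\alpha\in\Phi^+}\mathfrak g_\alpha$ and $\mathfrak t$ acting through $\mathfrak t\xrightarrow{\mathrm{ad}}\mathfrak{so}(\mathfrak q)\subset\mathbf C(\mathfrak q)\to\mathrm{End}(\mathbf S)$ (Clifford multiplication), $\mathfrak q$ being the Killing-orthogonal complement of $\mathfrak t$. Its set of weights is $\Lambda(\mathbf S)=\{\mu(A):A\subset\Phi^+\}$ with $\mu(A)=\frac12\big(\sum_{\alpha\in\Phi^+\setminus A}\alpha-\sum_{\alpha\in A}\alpha\big)$; $\Lambda^+(\mathbf S)$ is the subset of dominant weights in $\Lambda(\mathbf S)$. $\mathcal P(n)$ is the set of sequences of nonnegative integers $\lambda=(\lambda_1\ge\cdots\ge\lambda_n)$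 with $\lambda_1+\cdots+\lambda_n=\binom n2$ and $\lambda_1+\cdots+\lambda_i\le(n-1)+\cdots+(n-i)$ for all $i\in\{1,\ldots,n\}$. For such $\lambda$, $\mu[\lambda]=(\lambda_1-\lambda_2)\varpi_1+\cdots+(\lambda_{n-1}-\lambda_n)\varpi_{n-1}$. *)

theory Defs
  imports Jordan_Normal_Form.Matrix "HOL-Library.FuncSet" Complex_Main
begin

text \<open>
  Rows and columns of matrices are numbered from 0, as in the matrix library. Hence
  \<open>eps n i\<close> below is the functional usually written \<open>\<epsilon>\<close> with index \<open>i + 1\<close>, and positive
  roots are pairs \<open>(i, j)\<close> with \<open>i < j < n\<close>.
\<close>

section \<open>The Lie algebra and its Cartan subalgebra\<close>

definition bracket :: "complex mat \<Rightarrow> complex mat \<Rightarrow> complex mat" where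
  "bracket X Y = X * Y - Y * X"

definition unit_matrix :: "nat \<Rightarrow> nat \<Rightarrow> nat \<Rightarrow> complex mat" where
  "unit_matrix n i j = mat n n (\<lambda>(k, l). if k = i \<and> l = j then 1 else 0)"

definition sl :: "nat \<Rightarrow> complex mat set" where
  "sl n = {X \<in> carrier_mat n n. (\<Sum>i<n. X $$ (i, i)) = 0}"

definition cartan :: "nat \<Rightarrow> complex mat set" where
  "cartan n = {H \<in> sl n. diagonal_mat H}"

text \<open>
  The Killing form is the trace of \<open>ad X \<circ> ad Y\<close>. The trace is computed on the space of all
  \<open>n \<times> n\<close> matrices, with respect to the matrix units; since \<open>ad X\<close> maps all
  matrices into \<open>sl n\<close>, this is the same number as the trace on \<open>sl n\<close>.
\<close>

definition killing :: "nat \<Rightarrow> complex mat \<Rightarrow> complex mat \<Rightarrow> complex" where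
  "killing n X Y = (\<Sum>i<n. \<Sum>j<n. bracket X (bracket Y (unit_matrix n i j)) $$ (i, j))"

definition cartan_perp :: "nat \<Rightarrow> complex mat set" where
  "cartan_perp n = {X \<in> sl n. \<forall>H \<in> cartan n. killing n X H = 0}"

section \<open>Weights and roots\<close>

text \<open>
  Functionals on the Cartan subalgebra are extensional (\<open>undefined\<close> outside \<open>cartan n\<close>), so
  that equality of functions is equality of functionals. In particular the sum of all \<open>eps n i\<close>
  is the zero functional.
\<close>

definition cartan_dual :: "nat \<Rightarrow> (complex mat \<Rightarrow> complex) set" where
  "cartan_dual n = {\<xi> \<in> extensional (cartan n).
     (\<forall>H \<in> cartan n. \<forall>K \<in> cartan n. \<xi> (H + K) = \<xi> H + \<xi> K) \<and>
     (\<forall>c. \<forall>H \<in> cartan n. \<xi> (c \<cdot>\<^sub>m H) = c * \<xi> H)}"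

definition eps :: "nat \<Rightarrow> nat \<Rightarrow> complex mat \<Rightarrow> complex" where
  "eps n i = (\<lambda>H \<in> cartan n. H $$ (i, i))"

definition positive_roots :: "nat \<Rightarrow> (nat \<times> nat) set" where
  "positive_roots n = {(i, j). i < j \<and> j < n}"

definition root_functional :: "nat \<Rightarrow> nat \<times> nat \<Rightarrow> complex mat \<Rightarrow> complex" where
  "root_functional n = (\<lambda>(i, j). \<lambda>H \<in> cartan n. eps n i H - eps n j H)"

definition fund_weight :: "nat \<Rightarrow> nat \<Rightarrow> complex mat \<Rightarrow> complex" where
  "fund_weight n i = (\<lambda>H \<in> cartan n. \<Sum>k<i. eps n k H)"

definition dominant :: "nat \<Rightarrow> (complex mat \<Rightarrow> complex) \<Rightarrow> bool" where
  "dominant n \<xi> \<longleftrightarrow> (\<exists>x :: nat \<Rightarrow> real. (\<forall>i \<in> {1..n - 1}. 0 \<le> x i) \<and>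
     \<xi> = (\<lambda>H \<in> cartan n. \<Sum>i = 1..n - 1. of_real (x i) * fund_weight n i H))"

section \<open>The spin module\<close>

text \<open>
  The space of strictly upper triangular matrices has the root vectors
  \<open>unit_matrix n i j\<close> with \<open>(i, j) \<in> positive_roots n\<close> as a basis. Its exterior
  algebra therefore has as a basis the products of these root vectors over the subsets \<open>A\<close> of
  \<open>positive_roots n\<close>, the factors of each product being in lexicographic order. An element of
  the spin module is represented by its coordinates in this basis.
\<close>

type_synonym spinor = "(nat \<times> nat) set \<Rightarrow> complex"

definition spin_module :: "nat \<Rightarrow> spinor set" where
  "spin_module n = {f. \<forall>A. \<not> A \<subseteq> positive_roots n \<longrightarrow> f A = 0}"

text \<open>
  The sign that arises when the root vector of \<open>\<alpha>\<close> is moved past the factors indexed by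
  \<open>A\<close> that precede it.
\<close>

definition koszul_sign :: "nat \<times> nat \<Rightarrow> (nat \<times> nat) set \<Rightarrow> complex" where
  "koszul_sign \<alpha> A = (- 1) ^ card {\<beta> \<in> A. (\<beta>, \<alpha>) \<in> less_than <*lex*> less_than}"

text \<open>
  Left exterior multiplication by the root vector of \<open>\<alpha>\<close>, and contraction with the
  corresponding element of the dual basis (the odd derivation that sends this root vector to 1 and
  the other ones to 0).
\<close>

definition wedge :: "nat \<times> nat \<Rightarrow> spinor \<Rightarrow> spinor" where
  "wedge \<alpha> f = (\<lambda>A. if \<alpha> \<in> A then koszul_sign \<alpha> (A - {\<alpha>}) * f (A - {\<alpha>}) else 0)"

definition contract :: "nat \<times> nat \<Rightarrow> spinor \<Rightarrow> spinor" where
  "contract \<alpha> f = (\<lambda>A. if \<alpha> \<in> A then 0 else koszul_sign \<alpha> A * f (insert \<alpha> A))"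

text \<open>
  Clifford multiplication by \<open>X \<in> cartan_perp n\<close>, for the convention
  \<open>X Y + Y X = 2 killing X Y\<close> in the Clifford algebra: the upper triangular part of \<open>X\<close>
  acts by exterior multiplication, the lower triangular part by contraction with the functional
  \<open>2 killing X\<close> on the upper triangular matrices.
\<close>

definition clifford_mult :: "nat \<Rightarrow> complex mat \<Rightarrow> spinor \<Rightarrow> spinor" where
  "clifford_mult n X f = (\<lambda>A. \<Sum>(i, j) \<in> positive_roots n.
     X $$ (i, j) * wedge (i, j) f A
     + 2 * killing n X (unit_matrix n i j) * contract (i, j) f A)"

text \<open>
  The Killing-dual basis of the basis of \<open>cartan_perp n\<close> formed by the matrices
  \<open>unit_matrix n i j\<close> with \<open>i \<noteq> j\<close>.
\<close>

definition dual_unit_matrix :: "nat \<Rightarrow> nat \<Rightarrow> nat \<Rightarrow> complex mat" where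
  "dual_unit_matrix n i j =
     (1 / killing n (unit_matrix n i j) (unit_matrix n j i)) \<cdot>\<^sub>m unit_matrix n j i"

text \<open>
  The embedding of the Lie algebra of skew endomorphisms of a quadratic space into the Clifford
  algebra sends \<open>T\<close> to one quarter of the sum of the products \<open>T b * b'\<close>, where \<open>b\<close> runs
  through a basis and \<open>b'\<close> is the corresponding element of the dual basis; it is characterised
  by \<open>[T, X] = T X\<close> for all vectors \<open>X\<close>. The following is the action of this element on the
  spin module.
\<close>

definition spin_lift :: "nat \<Rightarrow> (complex mat \<Rightarrow> complex mat) \<Rightarrow> spinor \<Rightarrow> spinor" where
  "spin_lift n T f = (\<lambda>A. 1 / 4 * (\<Sum>(i, j) \<in> {(i, j). i < n \<and> j < n \<and> i \<noteq> j}.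
     clifford_mult n (T (unit_matrix n i j)) (clifford_mult n (dual_unit_matrix n i j) f) A))"

definition spin_action :: "nat \<Rightarrow> complex mat \<Rightarrow> spinor \<Rightarrow> spinor" where
  "spin_action n H = spin_lift n (bracket H)"

definition spin_weights :: "nat \<Rightarrow> (complex mat \<Rightarrow> complex) set" where
  "spin_weights n = {\<xi> \<in> cartan_dual n. \<exists>f \<in> spin_module n. f \<noteq> (\<lambda>A. 0) \<and>
     (\<forall>H \<in> cartan n. spin_action n H f = (\<lambda>A. \<xi> H * f A))}"

definition dominant_spin_weights :: "nat \<Rightarrow> (complex mat \<Rightarrow> complex) set" where
  "dominant_spin_weights n = {\<xi> \<in> spin_weights n. dominant n \<xi>}"

section \<open>Partitions\<close>

text \<open>The part with index \<open>i\<close> (counted from 1) of the partition \<open>p\<close> is \<open>p ! (i - 1)\<close>.\<close>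

definition partitions :: "nat \<Rightarrow> nat list set" where
  "partitions n = {p. length p = n \<and> sorted_wrt (\<ge>) p \<and> sum_list p = n choose 2 \<and>
     (\<forall>i \<in> {1..n}. (\<Sum>k = 1..i. p ! (k - 1)) \<le> (\<Sum>k = 1..i. n - k))}"

definition partition_weight :: "nat \<Rightarrow> nat list \<Rightarrow> complex mat \<Rightarrow> complex" where
  "partition_weight n p = (\<lambda>H \<in> cartan n. \<Sum>i = 1..n - 1.
     (of_nat (p ! (i - 1)) - of_nat (p ! i)) * fund_weight n i H)"

section \<open>Consistency of the model of the spin module\<close>

lemma unit_matrix_dim [simp]: "dim_row (unit_matrix n i j) = n" "dim_col (unit_matrix n i j) = n"
  by (auto simp: unit_matrix_def)

lemma unit_matrix_carrier [simp]: "unit_matrix n i j \<in> carrier_mat n n"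
  by (auto simp: unit_matrix_def)

lemma unit_matrix_index [simp]:
  "k < n \<Longrightarrow> l < n \<Longrightarrow> unit_matrix n i j $$ (k, l) = (if k = i \<and> l = j then 1 else 0)"
  by (auto simp: unit_matrix_def)

lemma bracket_index:
  assumes "X \<in> carrier_mat n n" "Y \<in> carrier_mat n n" "k < n" "l < n"
  shows "bracket X Y $$ (k, l) = (\<Sum>m<n. X $$ (k, m) * Y $$ (m, l) - Y $$ (k, m) * X $$ (m, l))"
  using assms by (auto simp: bracket_def scalar_prod_def sum_subtractf atLeast0LessThan)

lemma bracket_carrier:
  "X \<in> carrier_mat n n \<Longrightarrow> Y \<in> carrier_mat n n \<Longrightarrow> bracket X Y \<in> carrier_mat n n"
  by (auto simp: bracket_def)

lemma bracket_unit_index: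
  assumes "Y \<in> carrier_mat n n" "k < n" "l < n" "i < n" "j < n"
  shows "bracket Y (unit_matrix n i j) $$ (k, l) =
    (if l = j then Y $$ (k, i) else 0) - (if k = i then Y $$ (j, l) else 0)"
  using assms
  by (simp add: bracket_index sum_subtractf if_distrib[of "\<lambda>x. _ * x"] if_distrib[of "\<lambda>x. x * _"] flip: if_if_eq_conj cong: if_cong)

lemma killing_eq:
  assumes X: "X \<in> carrier_mat n n" and Y: "Y \<in> carrier_mat n n"
  shows "killing n X Y = 2 * of_nat n * (\<Sum>i<n. \<Sum>j<n. X $$ (i, j) * Y $$ (j, i))
    - 2 * (\<Sum>i<n. X $$ (i, i)) * (\<Sum>i<n. Y $$ (i, i))"
proof -
  have "bracket X (bracket Y (unit_matrix n i j)) $$ (i, j) =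
     (\<Sum>m<n. X $$ (i, m) * Y $$ (m, i)) - X $$ (i, i) * Y $$ (j, j)
     - Y $$ (i, i) * X $$ (j, j) + (\<Sum>m<n. Y $$ (j, m) * X $$ (m, j))" if "i < n" "j < n" for i j
  proof -
    have "bracket X (bracket Y (unit_matrix n i j)) $$ (i, j) =
     (\<Sum>m<n. X $$ (i, m) * (Y $$ (m, i) - (if m = i then Y $$ (j, j) else 0)) -
        ((if m = j then Y $$ (i, i) else 0) - Y $$ (j, m)) * X $$ (m, j))"
      using that by (simp add: bracket_index[OF X bracket_carrier[OF Y]] bracket_unit_index[OF Y])
    also have "\<dots> = (\<Sum>m<n. X $$ (i, m) * Y $$ (m, i) - (if m = i then X $$ (i, m) * Y $$ (j, j) else 0)
        - ((if m = j then Y $$ (i, i) * X $$ (m, j) else 0)) + Y $$ (j, m) * X $$ (m, j))"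
      by (rule sum.cong) (auto simp: algebra_simps)
    finally show ?thesis using that by (simp add: sum_subtractf sum.distrib)
  qed
  then have "killing n X Y = (\<Sum>i<n. \<Sum>j<n. (\<Sum>m<n. X $$ (i, m) * Y $$ (m, i)) - X $$ (i, i) * Y $$ (j, j)
     - Y $$ (i, i) * X $$ (j, j) + (\<Sum>m<n. Y $$ (j, m) * X $$ (m, j)))"
    by (simp add: killing_def)
  moreover have "(\<Sum>i<n. \<Sum>j<n. \<Sum>m<n. Y $$ (j, m) * X $$ (m, j)) = of_nat n * (\<Sum>i<n. \<Sum>j<n. X $$ (i, j) * Y $$ (j, i))"
    by (simp, subst sum.swap) (simp add: mult.commute)
  ultimately show ?thesis
    by (simp add: sum.distrib sum_subtractf sum_distrib_left[symmetric] sum_distrib_right[symmetric] algebra_simps)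
qed

lemma killing_unit_right:
  assumes "X \<in> carrier_mat n n" "i < n" "j < n" "i \<noteq> j"
  shows "killing n X (unit_matrix n i j) = 2 * of_nat n * X $$ (j, i)"
proof -
  have "(\<Sum>k<n. \<Sum>l<n. X $$ (k, l) * unit_matrix n i j $$ (l, k)) =
     (\<Sum>k<n. \<Sum>l<n. if l = i then if k = j then X $$ (j, i) else 0 else 0)"
    by (intro sum.cong) auto
  also have "\<dots> = X $$ (j, i)" using assms by simp
  finally have 1: "(\<Sum>k<n. \<Sum>l<n. X $$ (k, l) * unit_matrix n i j $$ (l, k)) = X $$ (j, i)" .
  have 2: "(\<Sum>k<n. unit_matrix n i j $$ (k, k)) = 0"
    using assms by (intro sum.neutral) auto
  show ?thesis by (simp only: killing_eq[OF assms(1) unit_matrix_carrier] 1 2) simp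
qed

lemma killing_diagonal:
  assumes "X \<in> sl n" "H \<in> cartan n"
  shows "killing n X H = 2 * of_nat n * (\<Sum>i<n. X $$ (i, i) * H $$ (i, i))"
proof -
  have "(\<Sum>i<n. \<Sum>j<n. X $$ (i, j) * H $$ (j, i)) = (\<Sum>i<n. \<Sum>j<n. if j = i then X $$ (i, i) * H $$ (i, i) else 0)"
    using assms by (intro sum.cong) (auto simp: cartan_def sl_def diagonal_mat_def)
  then show ?thesis using assms by (auto simp: killing_eq sl_def cartan_def)
qed

text \<open>The orthogonal complement of the Cartan subalgebra is the span of the root vectors.\<close>

lemma cartan_perp_eq:
  "cartan_perp n = {X \<in> carrier_mat n n. \<forall>i<n. X $$ (i, i) = 0}"
proof (intro equalityI subsetI)
  fix X :: "complex mat" assume X: "X \<in> cartan_perp n"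
  then have Xc: "X \<in> carrier_mat n n" and tr: "(\<Sum>i<n. X $$ (i, i)) = 0" and Xs: "X \<in> sl n"
    by (auto simp: cartan_perp_def sl_def)
  have eq: "X $$ (i, i) = X $$ (j, j)" if "i < n" "j < n" for i j
  proof (cases "i = j")
    case False
    let ?H = "unit_matrix n i i - unit_matrix n j j"
    have Hk: "?H $$ (k, k) = (if k = i then 1 else 0) - (if k = j then 1 else 0)" if "k < n" for k
      using that by auto
    have H: "?H \<in> cartan n"
      using that Hk by (auto simp: cartan_def sl_def diagonal_mat_def sum_subtractf)
    have "(\<Sum>k<n. X $$ (k, k) * ?H $$ (k, k)) =
      (\<Sum>k<n. (if k = i then X $$ (i, i) else 0) - (if k = j then X $$ (j, j) else 0))"
      using Hk by (intro sum.cong) (auto simp: algebra_simps)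
    also have "\<dots> = X $$ (i, i) - X $$ (j, j)" using that by (simp add: sum_subtractf)
    finally show ?thesis using X H killing_diagonal[OF Xs H] that by (auto simp: cartan_perp_def)
  qed simp
  have "X $$ (i, i) = 0" if "i < n" for i
  proof -
    have "(\<Sum>j<n. X $$ (j, j)) = (\<Sum>j<n. X $$ (i, i))"
      by (intro sum.cong refl eq) (use that in auto)
    then show ?thesis using tr that by auto
  qed
  then show "X \<in> {X \<in> carrier_mat n n. \<forall>i<n. X $$ (i, i) = 0}" using Xc by auto
next
  fix X :: "complex mat" assume "X \<in> {X \<in> carrier_mat n n. \<forall>i<n. X $$ (i, i) = 0}"
  then have "X \<in> sl n" and "\<And>i. i < n \<Longrightarrow> X $$ (i, i) = 0" by (auto simp: sl_def)
  then show "X \<in> cartan_perp n" by (auto simp: cartan_perp_def killing_diagonal)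
qed

lemma dual_unit_matrix:
  assumes "i < n" "j < n" "i \<noteq> j" "k < n" "l < n" "k \<noteq> l"
  shows "killing n (dual_unit_matrix n i j) (unit_matrix n k l) = (if (i, j) = (k, l) then 1 else 0)"
  using assms by (auto simp: dual_unit_matrix_def killing_unit_right)

lemma finite_positive_roots [simp]: "finite (positive_roots n)"
  by (rule finite_subset[of _ "{..<n} \<times> {..<n}"]) (auto simp: positive_roots_def)

abbreviation prec :: "nat \<times> nat \<Rightarrow> nat \<times> nat \<Rightarrow> bool" where
  "prec \<beta> \<alpha> \<equiv> (\<beta>, \<alpha>) \<in> less_than <*lex*> less_than"

lemma koszul_insert:
  assumes "finite A" "\<beta> \<notin> A"
  shows "koszul_sign \<alpha> (insert \<beta> A) = (if prec \<beta> \<alpha> then -1 else 1) * koszul_sign \<alpha> A"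
proof (cases "prec \<beta> \<alpha>")
  case True
  then have "{\<gamma> \<in> insert \<beta> A. prec \<gamma> \<alpha>} = insert \<beta> {\<gamma> \<in> A. prec \<gamma> \<alpha>}" by auto
  then show ?thesis using True assms by (simp add: koszul_sign_def)
next
  case False
  then have "{\<gamma> \<in> insert \<beta> A. prec \<gamma> \<alpha>} = {\<gamma> \<in> A. prec \<gamma> \<alpha>}" by auto
  then show ?thesis using False by (simp add: koszul_sign_def)
qed

lemma koszul_sq [simp]: "koszul_sign \<alpha> A * koszul_sign \<alpha> A = 1"
  "koszul_sign \<alpha> A * (koszul_sign \<alpha> A * x) = x"
  by (simp_all add: koszul_sign_def flip: power_add mult.assoc)

lemma prec_total: "\<alpha> \<noteq> \<beta> \<Longrightarrow> prec \<alpha> \<beta> \<longleftrightarrow> \<not> prec \<beta> \<alpha>"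
  by (cases \<alpha>; cases \<beta>) auto

lemma wedge_fin:
  "finite A \<Longrightarrow> \<alpha> \<notin> A \<Longrightarrow> wedge \<alpha> f (insert \<alpha> A) = koszul_sign \<alpha> A * f A"
  "\<alpha> \<notin> A \<Longrightarrow> wedge \<alpha> f A = 0"
  by (auto simp: wedge_def)

lemma contract_simps:
  "\<alpha> \<in> A \<Longrightarrow> contract \<alpha> f A = 0"
  "\<alpha> \<notin> A \<Longrightarrow> contract \<alpha> f A = koszul_sign \<alpha> A * f (insert \<alpha> A)"
  by (auto simp: contract_def)

lemma wedge_wedge:
  assumes "finite A"
  shows "wedge \<alpha> (wedge \<beta> f) A + wedge \<beta> (wedge \<alpha> f) A = 0"
proof (cases "\<alpha> \<in> A \<and> \<beta> \<in> A \<and> \<alpha> \<noteq> \<beta>")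
  case False then show ?thesis by (auto simp: wedge_def)
next
  case True
  define B where "B = A - {\<alpha>, \<beta>}"
  have e: "A - {\<alpha>} = insert \<beta> B" "A - {\<beta>} = insert \<alpha> B" "A - {\<alpha>} - {\<beta>} = B" "A - {\<beta>} - {\<alpha>} = B"
     "insert \<beta> B - {\<beta>} = B" "insert \<alpha> B - {\<alpha>} = B"
    using True by (auto simp: B_def)
  have B: "finite B" "\<alpha> \<notin> B" "\<beta> \<notin> B" using assms by (auto simp: B_def)
  have "wedge \<alpha> (wedge \<beta> f) A = koszul_sign \<alpha> (insert \<beta> B) * (koszul_sign \<beta> B * f B)"
    "wedge \<beta> (wedge \<alpha> f) A = koszul_sign \<beta> (insert \<alpha> B) * (koszul_sign \<alpha> B * f B)"
    using True by (simp_all add: wedge_def e)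
  then show ?thesis using prec_total[of \<alpha> \<beta>] True
    by (cases "prec \<beta> \<alpha>") (simp_all add: koszul_insert[OF B(1)] B)
qed

lemma contract_contract:
  assumes "finite A"
  shows "contract \<alpha> (contract \<beta> f) A + contract \<beta> (contract \<alpha> f) A = 0"
proof (cases "\<alpha> \<in> A \<or> \<beta> \<in> A \<or> \<alpha> = \<beta>")
  case True then show ?thesis by (auto simp: contract_def)
next
  case False
  then have ne: "\<alpha> \<notin> A" "\<beta> \<notin> A" "\<alpha> \<noteq> \<beta>" "\<beta> \<noteq> \<alpha>" by auto
  then have "contract \<alpha> (contract \<beta> f) A = koszul_sign \<alpha> A * (koszul_sign \<beta> (insert \<alpha> A) * f (insert \<alpha> (insert \<beta> A)))"
    "contract \<beta> (contract \<alpha> f) A = koszul_sign \<beta> A * (koszul_sign \<alpha> (insert \<beta> A) * f (insert \<alpha> (insert \<beta> A)))"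
    by (simp_all add: contract_def insert_commute)
  then show ?thesis using prec_total[of \<alpha> \<beta>] ne
    by (cases "prec \<beta> \<alpha>") (simp_all add: koszul_insert[OF assms])
qed

lemma wedge_contract:
  assumes "finite A"
  shows "wedge \<alpha> (contract \<beta> f) A + contract \<beta> (wedge \<alpha> f) A = (if \<alpha> = \<beta> then f A else 0)"
proof (cases "\<alpha> = \<beta>")
  case True
  show ?thesis
  proof (cases "\<alpha> \<in> A")
    case t: True
    then have "insert \<alpha> (A - {\<alpha>}) = A" by auto
    with t True show ?thesis by (auto simp: wedge_def contract_def insert_absorb)
  next
    case False with True show ?thesis by (auto simp: wedge_def contract_def)
  qed
next
  case ne: False
  show ?thesis
  proof (cases "\<alpha> \<in> A \<and> \<beta> \<notin> A")
    case True
    define B where "B = A - {\<alpha>}"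
    have e: "A = insert \<alpha> B" "\<alpha> \<notin> B" "\<beta> \<notin> B" "finite B" "insert \<beta> (insert \<alpha> B) - {\<alpha>} = insert \<beta> B"
      using True assms ne by (auto simp: B_def)
    have "wedge \<alpha> (contract \<beta> f) (insert \<alpha> B) = koszul_sign \<alpha> B * (koszul_sign \<beta> B * f (insert \<beta> B))"
      using e(2,3) ne by (simp add: wedge_def contract_def)
    moreover have "contract \<beta> (wedge \<alpha> f) (insert \<alpha> B) = koszul_sign \<beta> (insert \<alpha> B) * (koszul_sign \<alpha> (insert \<beta> B) * f (insert \<beta> B))"
      using e(2,3,5) ne by (simp add: wedge_def contract_def)
    ultimately show ?thesis unfolding e(1) using ne prec_total[of \<alpha> \<beta>]
      by (cases "prec \<beta> \<alpha>") (simp_all add: koszul_insert[OF e(4)] e(2,3))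
  next
    case False with ne show ?thesis by (auto simp: wedge_def contract_def)
  qed
qed

lemma clifford_mult_eq:
  assumes "X \<in> carrier_mat n n"
  shows "clifford_mult n X f A = (\<Sum>\<alpha>\<in>positive_roots n.
     X $$ \<alpha> * wedge \<alpha> f A + 4 * of_nat n * X $$ (snd \<alpha>, fst \<alpha>) * contract \<alpha> f A)"
  unfolding clifford_mult_def
  by (intro sum.cong refl) (auto simp: positive_roots_def killing_unit_right[OF assms])

lemma wedge_module: "\<alpha> \<in> positive_roots n \<Longrightarrow> f \<in> spin_module n \<Longrightarrow> wedge \<alpha> f \<in> spin_module n"
  unfolding spin_module_def mem_Collect_eq
proof (intro allI impI)
  fix A assume f: "\<alpha> \<in> positive_roots n" "\<forall>A. \<not> A \<subseteq> positive_roots n \<longrightarrow> f A = 0"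
    and A: "\<not> A \<subseteq> positive_roots n"
  then have "\<not> A - {\<alpha>} \<subseteq> positive_roots n" by auto
  with f show "wedge \<alpha> f A = 0" by (simp add: wedge_def)
qed

lemma contract_module: "f \<in> spin_module n \<Longrightarrow> contract \<alpha> f \<in> spin_module n"
  by (auto simp: spin_module_def contract_def)

lemma clifford_mult_module: "f \<in> spin_module n \<Longrightarrow> clifford_mult n X f \<in> spin_module n"
  unfolding spin_module_def mem_Collect_eq
proof (intro allI impI)
  fix A assume f: "\<forall>A. \<not> A \<subseteq> positive_roots n \<longrightarrow> f A = 0" and A: "\<not> A \<subseteq> positive_roots n"
  then have "wedge \<alpha> f A = 0" "contract \<alpha> f A = 0" if "\<alpha> \<in> positive_roots n" for \<alpha>
    using wedge_module[OF that, of f] contract_module[of f n] by (simp_all add: spin_module_def)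
  then show "clifford_mult n X f A = 0"
    unfolding clifford_mult_def by (auto intro!: sum.neutral)
qed

lemma wedge_sum: "wedge \<alpha> (\<lambda>A. \<Sum>x\<in>I. g x A) A = (\<Sum>x\<in>I. wedge \<alpha> (g x) A)"
  by (simp add: wedge_def sum_distrib_left)
lemma contract_sum: "contract \<alpha> (\<lambda>A. \<Sum>x\<in>I. g x A) A = (\<Sum>x\<in>I. contract \<alpha> (g x) A)"
  by (simp add: contract_def sum_distrib_left)
lemma wedge_lin: "wedge \<alpha> (\<lambda>A. a * g A + b * h A) A = a * wedge \<alpha> g A + b * wedge \<alpha> h A"
  by (simp add: wedge_def algebra_simps)
lemma contract_lin: "contract \<alpha> (\<lambda>A. a * g A + b * h A) A = a * contract \<alpha> g A + b * contract \<alpha> h A"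
  by (simp add: contract_def algebra_simps)

lemma roots_sum:
  assumes "\<And>i. i < n \<Longrightarrow> F i i = (0::complex)"
  shows "(\<Sum>\<alpha>\<in>positive_roots n. F (fst \<alpha>) (snd \<alpha>) + F (snd \<alpha>) (fst \<alpha>)) = (\<Sum>i<n. \<Sum>j<n. F i j)"
proof -
  let ?N = "(\<lambda>(i,j). (j,i)) ` positive_roots n"
  let ?D = "(\<lambda>i. (i,i)) ` {..<n}"
  have "(\<Sum>i<n. \<Sum>j<n. F i j) = (\<Sum>(i,j)\<in>{..<n}\<times>{..<n}. F i j)" by (simp add: sum.cartesian_product)
  also have "{..<n}\<times>{..<n} = (positive_roots n \<union> ?N) \<union> ?D"
    by (auto simp: positive_roots_def image_iff)
  also have "(\<Sum>(i,j)\<in>(positive_roots n \<union> ?N) \<union> ?D. F i j) = (\<Sum>(i,j)\<in>positive_roots n. F i j) + (\<Sum>(i,j)\<in>?N. F i j) + (\<Sum>(i,j)\<in>?D. F i j)"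
  proof -
    have d: "(positive_roots n \<union> ?N) \<inter> ?D = {}" "positive_roots n \<inter> ?N = {}" by (auto simp: positive_roots_def)
    show ?thesis by (simp add: sum.union_disjoint d)
  qed
  also have "(\<Sum>(i,j)\<in>?D. F i j) = 0" using assms by (intro sum.neutral) auto
  also have "(\<Sum>(i,j)\<in>?N. F i j) = (\<Sum>(i,j)\<in>positive_roots n. F j i)"
    by (subst sum.reindex) (auto simp: inj_on_def intro!: sum.cong)
  finally show ?thesis by (simp add: sum.distrib case_prod_unfold)
qed

lemma clifford_mult_mult:
  assumes "X \<in> carrier_mat n n" "Y \<in> carrier_mat n n"
  shows "clifford_mult n X (clifford_mult n Y f) A = (\<Sum>\<alpha>\<in>positive_roots n. \<Sum>\<beta>\<in>positive_roots n.
     X $$ \<alpha> * Y $$ \<beta> * wedge \<alpha> (wedge \<beta> f) A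
     + X $$ \<alpha> * (4 * of_nat n * Y $$ (snd \<beta>, fst \<beta>)) * wedge \<alpha> (contract \<beta> f) A
     + (4 * of_nat n * X $$ (snd \<alpha>, fst \<alpha>)) * Y $$ \<beta> * contract \<alpha> (wedge \<beta> f) A
     + (4 * of_nat n * X $$ (snd \<alpha>, fst \<alpha>)) * (4 * of_nat n * Y $$ (snd \<beta>, fst \<beta>)) * contract \<alpha> (contract \<beta> f) A)"
proof -
  have Y: "clifford_mult n Y f = (\<lambda>A. \<Sum>\<beta>\<in>positive_roots n.
     Y $$ \<beta> * wedge \<beta> f A + 4 * of_nat n * Y $$ (snd \<beta>, fst \<beta>) * contract \<beta> f A)"
    using clifford_mult_eq[OF assms(2)] by auto
  show ?thesis
    unfolding clifford_mult_eq[OF assms(1)] Y wedge_sum contract_sum wedge_lin contract_lin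
    by (simp add: sum_distrib_left distrib_left sum.distrib mult.assoc)
qed

text \<open>The spin module is a module over the Clifford algebra of \<open>cartan_perp n\<close>.\<close>

lemma clifford_relation:
  assumes "X \<in> cartan_perp n" "Y \<in> cartan_perp n" "f \<in> spin_module n"
  shows "clifford_mult n X (clifford_mult n Y f) A + clifford_mult n Y (clifford_mult n X f) A
    = 2 * killing n X Y * f A"
proof (cases "finite A")
  case False
  then have "\<not> A \<subseteq> positive_roots n" using finite_subset[OF _ finite_positive_roots] by blast
  then show ?thesis using assms(3) clifford_mult_module[OF clifford_mult_module[OF assms(3)]]
    by (simp add: spin_module_def)
next
  case A: True
  let ?P = "positive_roots n"
  have X: "X \<in> carrier_mat n n" "\<And>i. i < n \<Longrightarrow> X $$ (i, i) = 0"
   and Y: "Y \<in> carrier_mat n n" "\<And>i. i < n \<Longrightarrow> Y $$ (i, i) = 0"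
    using assms by (auto simp: cartan_perp_eq)
  let ?c = "4 * of_nat n :: complex"
  have "clifford_mult n X (clifford_mult n Y f) A + clifford_mult n Y (clifford_mult n X f) A =
    (\<Sum>\<alpha>\<in>?P. \<Sum>\<beta>\<in>?P.
     X $$ \<alpha> * Y $$ \<beta> * (wedge \<alpha> (wedge \<beta> f) A + wedge \<beta> (wedge \<alpha> f) A)
     + X $$ \<alpha> * (?c * Y $$ (snd \<beta>, fst \<beta>)) * (wedge \<alpha> (contract \<beta> f) A + contract \<beta> (wedge \<alpha> f) A)
     + (?c * X $$ (snd \<alpha>, fst \<alpha>)) * Y $$ \<beta> * (wedge \<beta> (contract \<alpha> f) A + contract \<alpha> (wedge \<beta> f) A)
     + (?c * X $$ (snd \<alpha>, fst \<alpha>)) * (?c * Y $$ (snd \<beta>, fst \<beta>)) * (contract \<alpha> (contract \<beta> f) A + contract \<beta> (contract \<alpha> f) A))"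
    unfolding clifford_mult_mult[OF X(1) Y(1)] clifford_mult_mult[OF Y(1) X(1)]
    by (subst (2) sum.swap) (simp add: sum.distrib algebra_simps)
  also have "\<dots> = (\<Sum>\<alpha>\<in>?P. \<Sum>\<beta>\<in>?P. if \<alpha> = \<beta> then ?c * (X $$ \<alpha> * Y $$ (snd \<alpha>, fst \<alpha>) + X $$ (snd \<alpha>, fst \<alpha>) * Y $$ \<alpha>) * f A else 0)"
    unfolding wedge_wedge[OF A] contract_contract[OF A] wedge_contract[OF A]
    by (intro sum.cong refl) (simp add: algebra_simps)
  also have "\<dots> = ?c * (\<Sum>\<alpha>\<in>?P. X $$ \<alpha> * Y $$ (snd \<alpha>, fst \<alpha>) + X $$ (snd \<alpha>, fst \<alpha>) * Y $$ \<alpha>) * f A"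
    by (simp add: sum_distrib_left sum_distrib_right)
  also have "(\<Sum>\<alpha>\<in>?P. X $$ \<alpha> * Y $$ (snd \<alpha>, fst \<alpha>) + X $$ (snd \<alpha>, fst \<alpha>) * Y $$ \<alpha>)
     = (\<Sum>i<n. \<Sum>j<n. X $$ (i, j) * Y $$ (j, i))"
    using roots_sum[of n "\<lambda>i j. X $$ (i, j) * Y $$ (j, i)"] X by simp
  finally show ?thesis using X Y by (simp add: killing_eq)
qed

text \<open>
  The half sum of the positive roots outside \<open>A\<close> minus the half sum of the roots in
  \<open>A\<close>; by \<open>spin_weights_eq\<close> these are exactly the weights of the spin module.
\<close>

definition spin_weight_of :: "nat \<Rightarrow> (nat \<times> nat) set \<Rightarrow> complex mat \<Rightarrow> complex" where
  "spin_weight_of n A = (\<lambda>H \<in> cartan n. 1 / 2 *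
     ((\<Sum>\<alpha> \<in> positive_roots n - A. root_functional n \<alpha> H) - (\<Sum>\<alpha> \<in> A. root_functional n \<alpha> H)))"

lemma bracket_cartan_unit:
  assumes "H \<in> cartan n" "i < n" "j < n"
  shows "bracket H (unit_matrix n i j) = (H $$ (i, i) - H $$ (j, j)) \<cdot>\<^sub>m unit_matrix n i j"
proof (rule eq_matI)
  show "dim_row (bracket H (unit_matrix n i j)) = dim_row ((H $$ (i, i) - H $$ (j, j)) \<cdot>\<^sub>m unit_matrix n i j)"
   "dim_col (bracket H (unit_matrix n i j)) = dim_col ((H $$ (i, i) - H $$ (j, j)) \<cdot>\<^sub>m unit_matrix n i j)"
    using assms by (auto simp: bracket_def cartan_def sl_def)
next
  fix k l assume "k < dim_row ((H $$ (i, i) - H $$ (j, j)) \<cdot>\<^sub>m unit_matrix n i j)"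
    "l < dim_col ((H $$ (i, i) - H $$ (j, j)) \<cdot>\<^sub>m unit_matrix n i j)"
  then show "bracket H (unit_matrix n i j) $$ (k, l) = ((H $$ (i, i) - H $$ (j, j)) \<cdot>\<^sub>m unit_matrix n i j) $$ (k, l)"
    using assms by (auto simp: bracket_unit_index cartan_def sl_def diagonal_mat_def)
qed

lemma clifford_unit:
  assumes "(i, j) \<in> positive_roots n"
  shows "clifford_mult n (c \<cdot>\<^sub>m unit_matrix n i j) f = (\<lambda>A. c * wedge (i, j) f A)"
    "clifford_mult n (c \<cdot>\<^sub>m unit_matrix n j i) f = (\<lambda>A. c * (4 * of_nat n) * contract (i, j) f A)"
proof -
  have "clifford_mult n (c \<cdot>\<^sub>m unit_matrix n i j) f A = (\<Sum>\<alpha>\<in>positive_roots n. if \<alpha> = (i, j) then c * wedge (i, j) f A else 0)" for A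
    using assms by (subst clifford_mult_eq) (auto simp: positive_roots_def intro!: sum.cong)
  then show "clifford_mult n (c \<cdot>\<^sub>m unit_matrix n i j) f = (\<lambda>A. c * wedge (i, j) f A)"
    using assms by auto
  have "clifford_mult n (c \<cdot>\<^sub>m unit_matrix n j i) f A = (\<Sum>\<alpha>\<in>positive_roots n. if \<alpha> = (i, j) then c * (4 * of_nat n) * contract (i, j) f A else 0)" for A
    using assms by (subst clifford_mult_eq) (auto simp: positive_roots_def intro!: sum.cong)
  then show "clifford_mult n (c \<cdot>\<^sub>m unit_matrix n j i) f = (\<lambda>A. c * (4 * of_nat n) * contract (i, j) f A)"
    using assms by auto
qed

lemma wedge_scale: "wedge \<alpha> (\<lambda>A. c * f A) A = c * wedge \<alpha> f A" by (simp add: wedge_def)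
lemma contract_scale: "contract \<alpha> (\<lambda>A. c * f A) A = c * contract \<alpha> f A" by (simp add: contract_def)

lemma off_diagonal_sum:
  "(\<Sum>(i, j) \<in> {(i, j). i < n \<and> j < n \<and> i \<noteq> j}. F i j) = (\<Sum>(i, j)\<in>positive_roots n. F i j + F j i :: complex)"
proof -
  let ?N = "(\<lambda>(i,j). (j,i)) ` positive_roots n"
  have e: "{(i, j). i < n \<and> j < n \<and> i \<noteq> j} = positive_roots n \<union> ?N"
    by (auto simp: positive_roots_def image_iff)
  have "(\<Sum>(i,j)\<in>?N. F i j) = (\<Sum>(i,j)\<in>positive_roots n. F j i)"
    by (subst sum.reindex) (auto simp: inj_on_def intro!: sum.cong)
  moreover have d: "positive_roots n \<inter> ?N = {}" by (auto simp: positive_roots_def)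
  ultimately have "(\<Sum>(i,j)\<in>positive_roots n \<union> ?N. F i j) = (\<Sum>(i,j)\<in>positive_roots n. F i j) + (\<Sum>(i,j)\<in>positive_roots n. F j i)"
    by (subst sum.union_disjoint[OF finite_positive_roots finite_imageI[OF finite_positive_roots] d]) simp
  then show ?thesis unfolding e by (simp add: sum.distrib case_prod_unfold)
qed

lemma spin_action_eq:
  assumes H: "H \<in> cartan n" and f: "f \<in> spin_module n"
  shows "spin_action n H f A = spin_weight_of n (positive_roots n - A) H * f A"
proof (cases "A \<subseteq> positive_roots n")
  case False
  have "spin_action n H f \<in> spin_module n"
    using clifford_mult_module[OF clifford_mult_module[OF f]]
    unfolding spin_action_def spin_lift_def spin_module_def
    by (auto intro!: sum.neutral)
  with False f show ?thesis by (simp add: spin_module_def)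
next
  case True
  let ?P = "positive_roots n"
  have A: "finite A" using True finite_subset finite_positive_roots by blast
  let ?r = "\<lambda>(i, j). H $$ (i, i) - H $$ (j, j)"
  have *: "clifford_mult n (bracket H (unit_matrix n i j)) (clifford_mult n (dual_unit_matrix n i j) f) A
     + clifford_mult n (bracket H (unit_matrix n j i)) (clifford_mult n (dual_unit_matrix n j i) f) A
     = 2 * (?r (i, j) * (wedge (i, j) (contract (i, j) f) A - contract (i, j) (wedge (i, j) f) A))"
    if ij: "(i, j) \<in> ?P" for i j
  proof -
    have l: "i < n" "j < n" "i \<noteq> j" "j \<noteq> i" "n > 0" using ij by (auto simp: positive_roots_def)
    show ?thesis
      unfolding dual_unit_matrix_def bracket_cartan_unit[OF H l(1,2)] bracket_cartan_unit[OF H l(2,1)]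
        clifford_unit[OF ij] wedge_scale contract_scale
      using l by (simp add: killing_unit_right) (simp add: field_simps)
  qed
  have **: "wedge \<alpha> (contract \<alpha> f) A - contract \<alpha> (wedge \<alpha> f) A = (if \<alpha> \<in> A then f A else - f A)" for \<alpha>
  proof -
    have "insert \<alpha> (A - {\<alpha>}) = A" if "\<alpha> \<in> A" using that by auto
    then show ?thesis by (auto simp: wedge_def contract_def)
  qed
  have "spin_action n H f A = 1 / 4 * (\<Sum>\<alpha>\<in>?P. 2 * (?r \<alpha> * (if \<alpha> \<in> A then f A else - f A)))"
    unfolding spin_action_def spin_lift_def off_diagonal_sum
    by (intro arg_cong[where f = "\<lambda>x. 1 / 4 * x"] sum.cong refl) (auto simp: * simp flip: **)
  also have "\<dots> = 1 / 2 * ((\<Sum>\<alpha>\<in>A. ?r \<alpha> * f A) - (\<Sum>\<alpha>\<in>?P - A. ?r \<alpha> * f A))"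
  proof -
    have "(\<Sum>\<alpha>\<in>?P. 2 * (?r \<alpha> * (if \<alpha> \<in> A then f A else - f A))) =
      (\<Sum>\<alpha>\<in>?P - A. 2 * (?r \<alpha> * (if \<alpha> \<in> A then f A else - f A))) + (\<Sum>\<alpha>\<in>A. 2 * (?r \<alpha> * (if \<alpha> \<in> A then f A else - f A)))"
      by (rule sum.subset_diff[OF True finite_positive_roots])
    also have "(\<Sum>\<alpha>\<in>?P - A. 2 * (?r \<alpha> * (if \<alpha> \<in> A then f A else - f A))) = - (2 * (\<Sum>\<alpha>\<in>?P - A. ?r \<alpha> * f A))"
      unfolding sum_distrib_left sum_negf[symmetric]
      by (intro sum.cong) auto
    also have "(\<Sum>\<alpha>\<in>A. 2 * (?r \<alpha> * (if \<alpha> \<in> A then f A else - f A))) = 2 * (\<Sum>\<alpha>\<in>A. ?r \<alpha> * f A)"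
      unfolding sum_distrib_left
      by (intro sum.cong) auto
    finally show ?thesis by simp
  qed
  also have "\<dots> = spin_weight_of n (?P - A) H * f A"
    using H True by (simp add: spin_weight_of_def double_diff root_functional_def eps_def case_prod_unfold sum_distrib_right left_diff_distrib)
  finally show ?thesis .
qed

lemma spin_weight_of_alt:
  assumes "H \<in> cartan n" "B \<subseteq> positive_roots n"
  shows "spin_weight_of n B H = 1 / 2 * (\<Sum>\<alpha>\<in>positive_roots n. root_functional n \<alpha> H) - (\<Sum>\<alpha>\<in>B. root_functional n \<alpha> H)"
  using assms sum.subset_diff[OF assms(2) finite_positive_roots, of "\<lambda>\<alpha>. root_functional n \<alpha> H"]
  by (simp add: spin_weight_of_def field_simps)

text \<open>
  The operator \<open>spin_action n H\<close> lifts \<open>ad H\<close>: this is the property that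
  characterises the embedding of the orthogonal Lie algebra into the Clifford algebra.
\<close>

lemma spin_action_clifford:
  assumes H: "H \<in> cartan n" and X: "X \<in> cartan_perp n" and f: "f \<in> spin_module n"
  shows "spin_action n H (clifford_mult n X f) A - clifford_mult n X (spin_action n H f) A
    = clifford_mult n (bracket H X) f A"
proof -
  let ?P = "positive_roots n"
  let ?w = "\<lambda>A. spin_weight_of n (?P - A) H"
  have Xc: "X \<in> carrier_mat n n" using X by (auto simp: cartan_perp_eq)
  have Hc: "H \<in> carrier_mat n n" using H by (auto simp: cartan_def sl_def)
  have w: "?w A - ?w (A - {\<alpha>}) = root_functional n \<alpha> H" if "\<alpha> \<in> A" "\<alpha> \<in> ?P" for \<alpha> A
  proof -
    have "?P - (A - {\<alpha>}) = insert \<alpha> (?P - A)" using that by auto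
    with that show ?thesis
      by (simp add: spin_weight_of_alt[OF H])
  qed
  have sf: "spin_action n H f = (\<lambda>A. ?w A * f A)" using spin_action_eq[OF H f] by auto
  have 1: "?w A * wedge \<alpha> f A - wedge \<alpha> (\<lambda>A. ?w A * f A) A = root_functional n \<alpha> H * wedge \<alpha> f A"
    if "\<alpha> \<in> ?P" for \<alpha>
    using w[of \<alpha> A] that by (auto simp: wedge_def algebra_simps)
  have 2: "?w A * contract \<alpha> f A - contract \<alpha> (\<lambda>A. ?w A * f A) A = - root_functional n \<alpha> H * contract \<alpha> f A"
    if "\<alpha> \<in> ?P" for \<alpha>
  proof (cases "\<alpha> \<in> A")
    case False
    then have "?w (insert \<alpha> A) = ?w A + root_functional n \<alpha> H"
      using w[of \<alpha> "insert \<alpha> A"] that by (simp add: insert_Diff_if algebra_simps)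
    with False show ?thesis by (simp add: contract_def algebra_simps)
  qed (simp add: contract_def)
  have b: "bracket H X $$ (k, l) = (H $$ (k, k) - H $$ (l, l)) * X $$ (k, l)" if "k < n" "l < n" for k l
  proof -
    have "bracket H X $$ (k, l) = (\<Sum>m<n. (if m = k then H $$ (k, k) * X $$ (k, l) else 0) - (if m = l then X $$ (k, l) * H $$ (l, l) else 0))"
      unfolding bracket_index[OF Hc Xc that]
      using H that by (intro sum.cong) (auto simp: cartan_def sl_def diagonal_mat_def)
    also have "\<dots> = (H $$ (k, k) - H $$ (l, l)) * X $$ (k, l)"
      using that by (simp add: sum_subtractf algebra_simps)
    finally show ?thesis .
  qed
  have r: "bracket H X $$ \<alpha> = root_functional n \<alpha> H * X $$ \<alpha>"
    "bracket H X $$ (snd \<alpha>, fst \<alpha>) = - root_functional n \<alpha> H * X $$ (snd \<alpha>, fst \<alpha>)" if "\<alpha> \<in> ?P" for \<alpha>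
    using b that H by (auto simp: positive_roots_def root_functional_def eps_def algebra_simps)
  have "spin_action n H (clifford_mult n X f) A - clifford_mult n X (spin_action n H f) A =
    (\<Sum>\<alpha>\<in>?P. X $$ \<alpha> * (?w A * wedge \<alpha> f A - wedge \<alpha> (\<lambda>A. ?w A * f A) A)
       + 4 * of_nat n * X $$ (snd \<alpha>, fst \<alpha>) * (?w A * contract \<alpha> f A - contract \<alpha> (\<lambda>A. ?w A * f A) A))"
    unfolding spin_action_eq[OF H clifford_mult_module[OF f]] sf clifford_mult_eq[OF Xc]
      sum_distrib_left sum_subtractf[symmetric]
    by (intro sum.cong refl) (simp add: algebra_simps)
  also have "\<dots> = clifford_mult n (bracket H X) f A"
    unfolding clifford_mult_eq[OF bracket_carrier[OF Hc Xc]]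
    by (intro sum.cong refl) (simp add: 1 2 r)
  finally show ?thesis .
qed

lemma spin_weight_of_dual:
  assumes "A \<subseteq> positive_roots n"
  shows "spin_weight_of n A \<in> cartan_dual n"
proof -
  have 1: "H + K \<in> cartan n" if "H \<in> cartan n" "K \<in> cartan n" for H K
    using that by (auto simp: cartan_def sl_def diagonal_mat_def sum.distrib)
  have 2: "c \<cdot>\<^sub>m H \<in> cartan n" if "H \<in> cartan n" for H c
    using that by (auto simp: cartan_def sl_def diagonal_mat_def sum_distrib_left[symmetric])
  have r: "\<alpha> \<in> positive_roots n \<Longrightarrow> root_functional n \<alpha> (H + K) = root_functional n \<alpha> H + root_functional n \<alpha> K"
    if "H \<in> cartan n" "K \<in> cartan n" for H K \<alpha>
    using that 1[OF that] by (auto simp: root_functional_def eps_def positive_roots_def case_prod_unfold cartan_def sl_def)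
  have r2: "\<alpha> \<in> positive_roots n \<Longrightarrow> root_functional n \<alpha> (c \<cdot>\<^sub>m H) = c * root_functional n \<alpha> H"
    if "H \<in> cartan n" for H c \<alpha>
    using that 2[OF that] by (auto simp: root_functional_def eps_def positive_roots_def case_prod_unfold cartan_def sl_def algebra_simps)
  have "(\<Sum>\<alpha>\<in>B. root_functional n \<alpha> (H + K)) = (\<Sum>\<alpha>\<in>B. root_functional n \<alpha> H) + (\<Sum>\<alpha>\<in>B. root_functional n \<alpha> K)"
    if "H \<in> cartan n" "K \<in> cartan n" "B \<subseteq> positive_roots n" for H K B
    unfolding sum.distrib[symmetric] using that r by (intro sum.cong) auto
  moreover have "(\<Sum>\<alpha>\<in>B. root_functional n \<alpha> (c \<cdot>\<^sub>m H)) = c * (\<Sum>\<alpha>\<in>B. root_functional n \<alpha> H)"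
    if "H \<in> cartan n" "B \<subseteq> positive_roots n" for H c B
    unfolding sum_distrib_left using that r2 by (intro sum.cong) auto
  ultimately show ?thesis using assms 1 2
    by (auto simp: cartan_dual_def spin_weight_of_def field_simps)
qed

lemma spin_weights_eq: "spin_weights n = spin_weight_of n ` Pow (positive_roots n)"
proof (intro equalityI subsetI)
  fix \<xi> assume "\<xi> \<in> spin_weights n"
  then obtain f where \<xi>: "\<xi> \<in> cartan_dual n" and f: "f \<in> spin_module n" "f \<noteq> (\<lambda>A. 0)"
    and e: "\<And>H. H \<in> cartan n \<Longrightarrow> spin_action n H f = (\<lambda>A. \<xi> H * f A)"
    by (auto simp: spin_weights_def)
  from f(2) obtain A where A: "f A \<noteq> 0" by auto
  have "\<xi> = spin_weight_of n (positive_roots n - A)"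
  proof
    fix H show "\<xi> H = spin_weight_of n (positive_roots n - A) H"
    proof (cases "H \<in> cartan n")
      case True
      from spin_action_eq[OF this f(1), of A] fun_cong[OF e[OF True], of A] A show ?thesis by simp
    next
      case False
      with \<xi> show ?thesis by (simp add: cartan_dual_def spin_weight_of_def extensional_def)
    qed
  qed
  then show "\<xi> \<in> spin_weight_of n ` Pow (positive_roots n)" by auto
next
  fix \<xi> assume "\<xi> \<in> spin_weight_of n ` Pow (positive_roots n)"
  then obtain B where B: "B \<subseteq> positive_roots n" "\<xi> = spin_weight_of n B" by auto
  define f :: spinor where "f = (\<lambda>A. if A = positive_roots n - B then 1 else 0)"
  have f: "f \<in> spin_module n" by (auto simp: f_def spin_module_def)
  have "f \<noteq> (\<lambda>A. 0)" by (auto simp: f_def fun_eq_iff)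
  moreover have "spin_action n H f = (\<lambda>A. \<xi> H * f A)" if "H \<in> cartan n" for H
  proof
    fix A show "spin_action n H f A = \<xi> H * f A"
      unfolding spin_action_eq[OF that f] using B by (auto simp: f_def double_diff)
  qed
  ultimately show "\<xi> \<in> spin_weights n"
    using f B spin_weight_of_dual by (auto simp: spin_weights_def)
qed

end

theory Submission
  imports Defs
begin

text \<open>
  A subset \<open>A\<close> of the positive roots is a tournament on \<open>n\<close> players: \<open>i\<close> beats
  \<open>j > i\<close> unless \<open>(i, j) \<in> A\<close>. Since the \<open>\<epsilon>\<close>-coefficients of a functional on the Cartan
  subalgebra matter only up to a common constant, the weight of \<open>A\<close> has the score sequence of
  the tournament as its coefficients, and dominance means that the scores are weakly
  decreasing. The claim thus becomes Landau's theorem on score sequences. For the existence of a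
  tournament with given scores \<open>r\<close>, start from the transitive tournament, whose partial sums of
  scores dominate those of \<open>r\<close>, and repeatedly reverse a path of length at most 2 from a player
  with too large a score to one with too small a score.
\<close>

section \<open>Score sequences of tournaments\<close>

definition tournament :: "nat \<Rightarrow> (nat \<Rightarrow> nat \<Rightarrow> bool) \<Rightarrow> bool" where
  "tournament n T \<longleftrightarrow> (\<forall>i<n. \<not> T i i \<and> (\<forall>j<i. T i j \<longleftrightarrow> \<not> T j i))"

definition score :: "nat \<Rightarrow> (nat \<Rightarrow> nat \<Rightarrow> bool) \<Rightarrow> nat \<Rightarrow> nat" where
  "score n T i = card {j. j < n \<and> T i j}"

lemma tournament_irrefl: "tournament n T \<Longrightarrow> i < n \<Longrightarrow> \<not> T i i"
  by (simp add: tournament_def)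

lemma tournament_flip: "tournament n T \<Longrightarrow> j < i \<Longrightarrow> i < n \<Longrightarrow> T i j \<longleftrightarrow> \<not> T j i"
  by (simp add: tournament_def)

lemma tournament_iff:
  assumes "tournament n T" "i < n" "j < n"
  shows "T i j \<longleftrightarrow> i \<noteq> j \<and> \<not> T j i"
  using tournament_irrefl[OF assms(1,2)] tournament_flip[OF assms(1) _ assms(2), of j]
    tournament_flip[OF assms(1) _ assms(3), of i]
  by (cases i j rule: linorder_cases) simp_all

text \<open>The target type stays general: scores are counted in the natural numbers but also serve
  as complex coefficients of weights.\<close>

lemma score_eq_sum: "of_nat (score n T i) = (\<Sum>j<n. of_bool (T i j))"
proof -
  have "{..<n} \<inter> {j. T i j} = {j. j < n \<and> T i j}" by auto
  then show ?thesis by (simp add: score_def sum.If_cases of_bool_def)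
qed

lemma score_eq_sum_nat: "score n T i = (\<Sum>j<n. of_bool (T i j))"
  using score_eq_sum[of n T i, where 'a = nat] by simp

lemma tournament_less: "tournament n (<)"
  by (auto simp: tournament_def)

text \<open>The transitive tournament realises \<open>n - 1, n - 2, ..., 0\<close>, whose partial
  sums are the upper bounds in \<open>partitions\<close>.\<close>

lemma score_less: "score n (<) k = n - Suc k"
proof -
  have "{j. j < n \<and> k < j} = {k<..<n}" by auto
  then show ?thesis by (simp add: score_def)
qed

section \<open>Reversing edges and short paths\<close>

definition reverse_edge :: "nat \<Rightarrow> nat \<Rightarrow> (nat \<Rightarrow> nat \<Rightarrow> bool) \<Rightarrow> nat \<Rightarrow> nat \<Rightarrow> bool" where
  "reverse_edge a b T = (\<lambda>i j. if {i, j} = {a, b} then T j i else T i j)"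

lemma tournament_reverse_edge: "tournament n T \<Longrightarrow> tournament n (reverse_edge a b T)"
  by (auto simp: tournament_def reverse_edge_def insert_commute)

text \<open>Only the rows of \<open>a\<close> and \<open>b\<close> change, by one win each. Both
  corrections are added rather than subtracted, which avoids truncated subtraction.\<close>

lemma score_reverse_edge:
  assumes T: "tournament n T" and ab: "a < n" "b < n" "T a b"
  shows "score n (reverse_edge a b T) k + of_bool (k = a) = score n T k + of_bool (k = b)"
proof -
  have ne: "a \<noteq> b" "\<not> T b a" using tournament_iff[OF T ab(1,2)] ab(3) by auto
  consider "k = a" | "k = b" | "k \<noteq> a" "k \<noteq> b" by auto
  then show ?thesis
  proof cases
    case 1
    have "{j. j < n \<and> T a j} = insert b {j. j < n \<and> reverse_edge a b T a j}"
      using ab ne by (auto simp: reverse_edge_def doubleton_eq_iff)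
    moreover have "\<not> reverse_edge a b T a b" using ne by (simp add: reverse_edge_def)
    ultimately show ?thesis using 1 ne by (simp add: score_def)
  next
    case 2
    have "{j. j < n \<and> reverse_edge a b T b j} = insert a {j. j < n \<and> T b j}"
      using ab ne by (auto simp: reverse_edge_def doubleton_eq_iff)
    then show ?thesis using 2 ne by (simp add: score_def)
  next
    case 3
    then have "reverse_edge a b T k = T k" by (auto simp: reverse_edge_def doubleton_eq_iff)
    then show ?thesis using 3 by (simp add: score_def)
  qed
qed

lemma score_exchange:
  assumes T: "tournament n T" and ab: "a < n" "b < n" and less: "score n T b < score n T a"
  obtains T' where "tournament n T'"
    "\<And>k. score n T' k + of_bool (k = a) = score n T k + of_bool (k = b)"
proof -
  \<comment> \<open>Having more wins than \<open>b\<close>, player \<open>a\<close> beats some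
    \<open>c\<close> that \<open>b\<close> does not beat. Either \<open>c\<close> is
    \<open>b\<close> itself, or \<open>a\<close>, \<open>c\<close>, \<open>b\<close> form a path to
    reverse; the intermediate \<open>c\<close> then gains one win and loses one.\<close>
  have "\<not> {j. j < n \<and> T a j} \<subseteq> {j. j < n \<and> T b j}"
    using less card_mono[of "{j. j < n \<and> T b j}" "{j. j < n \<and> T a j}"] by (auto simp: score_def)
  then obtain c where c: "c < n" "T a c" "\<not> T b c" by auto
  show ?thesis
  proof (cases "c = b")
    case True
    then show ?thesis
      using that[OF tournament_reverse_edge[OF T]] score_reverse_edge[OF T ab] c by blast
  next
    case False
    let ?T = "reverse_edge a c T"
    have "a \<noteq> b" using less by auto
    moreover have "T c b" using c False tournament_iff[OF T c(1) ab(2)] by auto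
    ultimately have cb: "?T c b"
      using False by (auto simp: reverse_edge_def doubleton_eq_iff)
    have "score n (reverse_edge c b ?T) k + of_bool (k = a) = score n T k + of_bool (k = b)" for k
      using score_reverse_edge[OF T ab(1) c(1,2), of k]
        score_reverse_edge[OF tournament_reverse_edge[OF T] c(1) ab(2) cb, of k] by simp
    then show ?thesis
      using that[OF tournament_reverse_edge[OF tournament_reverse_edge[OF T]]] by blast
  qed
qed

text \<open>The existence half of Landau's theorem, stated for an arbitrary starting tournament so
  that the induction can pass to the modified one.\<close>

lemma exists_tournament_dominated_score:
  fixes r :: "nat \<Rightarrow> nat"
  assumes decr: "\<And>i j. i \<le> j \<Longrightarrow> j < n \<Longrightarrow> r j \<le> r i"
    and "tournament n T"
    and "(\<Sum>k<n. r k) = (\<Sum>k<n. score n T k)"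
    and "\<And>i. i \<le> n \<Longrightarrow> (\<Sum>k<i. r k) \<le> (\<Sum>k<i. score n T k)"
  shows "\<exists>T'. tournament n T' \<and> (\<forall>k<n. score n T' k = r k)"
  using assms(2-)
\<comment> \<open>Truncated subtraction makes the measure the total surplus of the scores over
  \<open>r\<close>; deficits count as 0.\<close>
proof (induction "\<Sum>k<n. score n T k - r k" arbitrary: T rule: less_induct)
  case less
  note T = \<open>tournament n T\<close> and total = less.prems(2) and partial = less.prems(3)
  let ?s = "score n T"
  show ?case
  proof (cases "\<forall>k<n. ?s k = r k")
    case True
    with T show ?thesis by auto
  next
    case False
    \<comment> \<open>At the first disagreement, the partial sum bound for \<open>Suc a\<close>
      forces a surplus.\<close>
    define a where "a = (LEAST k. k < n \<and> ?s k \<noteq> r k)"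
    have a: "a < n" "?s a \<noteq> r a"
      using LeastI_ex[of "\<lambda>k. k < n \<and> ?s k \<noteq> r k"] False by (auto simp: a_def)
    have a_min: "?s k = r k" if "k < a" for k
      using not_less_Least[of k "\<lambda>k. k < n \<and> ?s k \<noteq> r k"] that a(1) by (auto simp: a_def)
    have sa: "r a < ?s a"
      using partial[of "Suc a"] a a_min by simp
    have "\<exists>k<n. ?s k < r k"
    proof (rule ccontr)
      assume "\<not> (\<exists>k<n. ?s k < r k)"
      then have "\<forall>k\<in>{..<n}. r k \<le> ?s k" by (metis lessThan_iff not_less)
      then have "(\<Sum>k<n. r k) < (\<Sum>k<n. ?s k)"
        using a sa by (intro sum_strict_mono_ex1) auto
      with total show False by simp
    qed
    \<comment> \<open>Equal totals force a deficit somewhere; \<open>b\<close> is the first one, and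
      it lies after \<open>a\<close>. Monotonicity of \<open>r\<close> gives
      \<open>?s b < r b \<le> r a < ?s a\<close>, so an exchange is possible.\<close>
    define b where "b = (LEAST k. k < n \<and> ?s k < r k)"
    have b: "b < n" "?s b < r b"
      using LeastI_ex[of "\<lambda>k. k < n \<and> ?s k < r k"] \<open>\<exists>k<n. ?s k < r k\<close> by (auto simp: b_def)
    have b_min: "r k \<le> ?s k" if "k < b" for k
      using not_less_Least[of k "\<lambda>k. k < n \<and> ?s k < r k"] that b(1) by (auto simp: b_def)
    have "a < b" using a_min[of b] b sa by (cases a b rule: linorder_cases) auto
    then have "?s b < ?s a" using decr[of a b] b sa by simp
    then obtain T' where T': "tournament n T'"
      and s': "\<And>k. score n T' k + of_bool (k = a) = ?s k + of_bool (k = b)"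
      using score_exchange[OF T a(1) b(1)] by metis
    let ?s' = "score n T'"
    have sums: "(\<Sum>k<i. ?s' k) + of_bool (a < i) = (\<Sum>k<i. ?s k) + of_bool (b < i)" for i
    proof -
      have "(\<Sum>k<i. ?s' k + of_bool (k = a)) = (\<Sum>k<i. ?s k + of_bool (k = b))"
        by (simp only: s')
      then show ?thesis by (simp add: sum.distrib of_bool_def)
    qed
    \<comment> \<open>The surplus at \<open>a\<close> drops by one, while \<open>b\<close>, which
      had a deficit, still has no surplus.\<close>
    have 1: "(\<Sum>k<n. ?s' k - r k) < (\<Sum>k<n. ?s k - r k)"
    proof (rule sum_strict_mono_ex1)
      show "\<forall>k\<in>{..<n}. ?s' k - r k \<le> ?s k - r k"
      proof
        fix k show "?s' k - r k \<le> ?s k - r k" using s'[of k] b(2) by (cases "k = b") auto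
      qed
      show "\<exists>k\<in>{..<n}. ?s' k - r k < ?s k - r k"
        using a sa s'[of a] \<open>a < b\<close> by (intro bexI[of _ a]) auto
    qed simp
    have 2: "(\<Sum>k<n. r k) = (\<Sum>k<n. ?s' k)" using sums[of n] a b total by simp
    have 3: "(\<Sum>k<i. r k) \<le> (\<Sum>k<i. ?s' k)" if "i \<le> n" for i
    \<comment> \<open>Only partial sums with \<open>a < i \<le> b\<close> decrease, by one. They had
      slack: before \<open>b\<close> there is no deficit, and at \<open>a\<close> the surplus is
      strict.\<close>
    proof (cases "a < i \<and> i \<le> b")
      case True
      then have "(\<Sum>k<i. r k) < (\<Sum>k<i. ?s k)"
        using sa b_min by (intro sum_strict_mono_ex1) auto
      with sums[of i] True show ?thesis by simp
    next
      case False
      with sums[of i] partial[OF that] \<open>a < b\<close> show ?thesis by (cases "a < i") auto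
    qed
    show ?thesis by (rule less.hyps[OF 1 T' 2 3])
  qed
qed

section \<open>Counting games: Landau's inequalities\<close>

lemma sum_diff_Suc: "i \<le> n \<Longrightarrow> (\<Sum>k<i. n - Suc k) = (i choose 2) + i * (n - i)"
proof (induction i)
  case (Suc i)
  then obtain d where "n = Suc i + d" using le_Suc_ex by blast
  with Suc show ?case by (simp add: numeral_2_eq_2)
qed simp

text \<open>Each game has exactly one winner; adding player \<open>i\<close> adds one game against
  each of the \<open>i\<close> earlier players.\<close>

lemma tournament_sum:
  assumes "tournament n T" "i \<le> n"
  shows "(\<Sum>k<i. \<Sum>j<i. of_bool (T k j)) = (i choose 2 :: nat)"
  using assms(2)
proof (induction i)
  case (Suc i)
  have "(\<Sum>k<i. of_bool (T k i)) + (\<Sum>k<i. of_bool (T i k)) = (\<Sum>k<i. 1 :: nat)"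
    unfolding sum.distrib[symmetric]
    using Suc.prems tournament_flip[OF assms(1), of _ i] by (intro sum.cong) auto
  moreover have "\<not> T i i" using Suc.prems tournament_irrefl[OF assms(1), of i] by auto
  ultimately show ?case using Suc by (simp add: sum.distrib numeral_2_eq_2)
qed simp

text \<open>The first \<open>i\<close> players share \<open>i choose 2\<close> wins among
  themselves, and each wins at most \<open>n - i\<close> games against the others. By
  \<open>sum_diff_Suc\<close> this total is the stated bound.\<close>

lemma score_partial_sum:
  assumes "tournament n T" "i \<le> n"
  shows "(\<Sum>k<i. score n T k) \<le> (\<Sum>k<i. n - Suc k)"
proof -
  have "score n T k \<le> (\<Sum>j<i. of_bool (T k j)) + (n - i)" for k
  proof -
    have "score n T k = (\<Sum>j<i. of_bool (T k j)) + (\<Sum>j=i..<n. of_bool (T k j))"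
      using sum.atLeastLessThan_concat[of 0 i n "\<lambda>j. of_bool (T k j) :: nat"] assms(2)
      by (simp add: score_eq_sum_nat atLeast0LessThan)
    also have "(\<Sum>j=i..<n. of_bool (T k j)) \<le> (\<Sum>j=i..<n. 1 :: nat)"
      by (intro sum_mono) auto
    finally show ?thesis by simp
  qed
  then have "(\<Sum>k<i. score n T k) \<le> (\<Sum>k<i. (\<Sum>j<i. of_bool (T k j)) + (n - i))"
    by (intro sum_mono)
  then show ?thesis
    by (simp add: sum.distrib tournament_sum[OF assms] sum_diff_Suc[OF assms(2)] del: sum_of_bool_eq)
qed

lemma score_sum: "tournament n T \<Longrightarrow> (\<Sum>k<n. score n T k) = n choose 2"
  by (simp only: score_eq_sum_nat tournament_sum order_refl)

section \<open>Functionals on the Cartan subalgebra\<close>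

definition diag_functional :: "nat \<Rightarrow> (nat \<Rightarrow> complex) \<Rightarrow> complex mat \<Rightarrow> complex" where
  "diag_functional n c = (\<lambda>H \<in> cartan n. \<Sum>k<n. c k * H $$ (k, k))"

lemma cartan_trace: "H \<in> cartan n \<Longrightarrow> (\<Sum>k<n. H $$ (k, k)) = 0"
  by (simp add: cartan_def sl_def)

text \<open>On traceless diagonal matrices exactly the constant coefficient vectors vanish.
  Comparing differences pairwise expresses this without naming the constant.\<close>

lemma diag_functional_eq_iff:
  "diag_functional n c = diag_functional n d \<longleftrightarrow> (\<forall>i<n. \<forall>j<n. c i - d i = c j - d j)"
proof (intro iffI allI impI)
  fix i j assume eq: "diag_functional n c = diag_functional n d" and ij: "i < n" "j < n"
  \<comment> \<open>Evaluation at this coroot reads off the difference of the coefficients at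
    \<open>i\<close> and \<open>j\<close>.\<close>
  let ?H = "unit_matrix n i i - unit_matrix n j j"
  have Hk: "?H $$ (k, k) = of_bool (k = i) - of_bool (k = j)" if "k < n" for k
    using that by auto
  have H: "?H \<in> cartan n"
    using ij Hk by (auto simp: cartan_def sl_def diagonal_mat_def sum_subtractf of_bool_def)
  have "diag_functional n e ?H = e i - e j" for e
  proof -
    have "diag_functional n e ?H = (\<Sum>k<n. (if k = i then e i else 0) - (if k = j then e j else 0))"
      using H unfolding diag_functional_def by (simp add: Hk) (intro sum.cong, auto)
    then show ?thesis using ij by (simp add: sum_subtractf)
  qed
  with eq have "c i - c j = d i - d j" by metis
  then show "c i - d i = c j - d j" by (simp add: algebra_simps)
next
  assume eq: "\<forall>i<n. \<forall>j<n. c i - d i = c j - d j"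
  show "diag_functional n c = diag_functional n d"
    unfolding diag_functional_def
  proof (rule restrict_ext)
    fix H assume H: "H \<in> cartan n"
    have "(\<Sum>k<n. c k * H $$ (k, k)) - (\<Sum>k<n. d k * H $$ (k, k)) = (\<Sum>k<n. (c 0 - d 0) * H $$ (k, k))"
      unfolding sum_subtractf[symmetric] left_diff_distrib[symmetric]
    proof (intro sum.cong refl)
      fix k assume "k \<in> {..<n}"
      then have "c k - d k = c 0 - d 0" using eq by (metis gr_implies_not0 lessThan_iff not_gr_zero)
      then show "(c k - d k) * H $$ (k, k) = (c 0 - d 0) * H $$ (k, k)" by simp
    qed
    also have "\<dots> = 0" by (simp add: cartan_trace[OF H] flip: sum_distrib_left)
    finally show "(\<Sum>k<n. c k * H $$ (k, k)) = (\<Sum>k<n. d k * H $$ (k, k))" by simp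
  qed
qed

text \<open>Interchange the sums: with indices from 0, \<open>eps n k\<close> occurs in
  \<open>fund_weight n i\<close> exactly when \<open>k < i\<close>. The coefficient at
  \<open>n - 1\<close> is the empty sum.\<close>

lemma fund_weight_combination:
  assumes "1 \<le> n"
  shows "(\<lambda>H \<in> cartan n. \<Sum>i = 1..n - 1. y i * fund_weight n i H)
    = diag_functional n (\<lambda>k. \<Sum>i = Suc k..n - 1. y i)"
  unfolding diag_functional_def
proof (rule restrict_ext)
  fix H assume H: "H \<in> cartan n"
  have "(\<Sum>i = 1..n - 1. y i * fund_weight n i H)
      = (\<Sum>i = 1..n - 1. \<Sum>k<n. if k < i then y i * H $$ (k, k) else 0)"
  proof (intro sum.cong refl)
    fix i assume "i \<in> {1..n - 1}"
    then have "{..<n} \<inter> {k. k < i} = {..<i}" by auto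
    then show "y i * fund_weight n i H = (\<Sum>k<n. if k < i then y i * H $$ (k, k) else 0)"
      using H by (simp add: fund_weight_def eps_def sum_distrib_left sum.If_cases)
  qed
  also have "\<dots> = (\<Sum>k<n. \<Sum>i = 1..n - 1. if k < i then y i * H $$ (k, k) else 0)"
    by (rule sum.swap)
  also have "\<dots> = (\<Sum>k<n. (\<Sum>i = Suc k..n - 1. y i) * H $$ (k, k))"
  proof (intro sum.cong refl)
    fix k
    have "{1..n - 1} \<inter> {i. k < i} = {Suc k..n - 1}" by auto
    then show "(\<Sum>i = 1..n - 1. if k < i then y i * H $$ (k, k) else 0)
        = (\<Sum>i = Suc k..n - 1. y i) * H $$ (k, k)"
      by (simp add: sum.If_cases sum_distrib_right)
  qed
  finally show "(\<Sum>i = 1..n - 1. y i * fund_weight n i H)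
    = (\<Sum>k<n. (\<Sum>i = Suc k..n - 1. y i) * H $$ (k, k))" .
qed

text \<open>The coefficients telescope to \<open>c k - c (n - 1)\<close>, which differ from
  \<open>c\<close> by a constant and so give the same functional.\<close>

lemma fund_weight_differences:
  assumes "1 \<le> n"
  shows "(\<lambda>H \<in> cartan n. \<Sum>i = 1..n - 1. (c (i - 1) - c i) * fund_weight n i H) = diag_functional n c"
proof -
  have "(\<Sum>i = Suc k..n - 1. c (i - 1) - c i) = c k - c (n - 1)" if "k < n" for k
  proof -
    have "(\<Sum>i = Suc k..n - 1. c (i - 1) - c i) = (\<Sum>i = Suc k..<Suc (n - 1). c (i - 1) - c i)"
      by (simp only: atLeastLessThanSuc_atLeastAtMost)
    also have "\<dots> = (\<Sum>i = k..<n - 1. c i - c (Suc i))"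
      by (simp only: sum.shift_bounds_Suc_ivl diff_Suc_1)
    also have "\<dots> = c k - c (n - 1)"
      using sum_Suc_diff'[of k "n - 1" "\<lambda>i. - c i"] that by simp
    finally show ?thesis .
  qed
  then show ?thesis
    unfolding fund_weight_combination[OF assms] diag_functional_eq_iff by simp
qed

lemma partition_weight_eq:
  "1 \<le> n \<Longrightarrow> partition_weight n p = diag_functional n (\<lambda>k. of_nat (p ! k))"
  unfolding partition_weight_def by (rule fund_weight_differences)

lemma dominant_diag_functional_iff:
  fixes c :: "nat \<Rightarrow> nat"
  assumes "1 \<le> n"
  shows "dominant n (diag_functional n (\<lambda>k. of_nat (c k))) \<longleftrightarrow> (\<forall>k. Suc k < n \<longrightarrow> c (Suc k) \<le> c k)"
proof (intro iffI allI impI)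
  fix k assume "dominant n (diag_functional n (\<lambda>k. of_nat (c k)))" and k: "Suc k < n"
  then obtain x :: "nat \<Rightarrow> real" where x: "\<forall>i \<in> {1..n - 1}. 0 \<le> x i"
    and eq: "diag_functional n (\<lambda>k. of_nat (c k)) = diag_functional n (\<lambda>k. \<Sum>i = Suc k..n - 1. of_real (x i))"
    unfolding dominant_def fund_weight_combination[OF assms] by blast
  \<comment> \<open>Comparing the neighbouring indices \<open>k\<close> and \<open>Suc k\<close>
    isolates the single coefficient \<open>x (Suc k)\<close> as
    \<open>c k - c (Suc k)\<close>.\<close>
  have "complex_of_nat (c k) - (\<Sum>i = Suc k..n - 1. of_real (x i))
      = of_nat (c (Suc k)) - (\<Sum>i = Suc (Suc k)..n - 1. of_real (x i))"
    by (rule eq[unfolded diag_functional_eq_iff, rule_format]) (use k in auto)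
  moreover have "(\<Sum>i = Suc k..n - 1. complex_of_real (x i))
      = of_real (x (Suc k)) + (\<Sum>i = Suc (Suc k)..n - 1. of_real (x i))"
    using k by (intro sum.atLeast_Suc_atMost) auto
  ultimately have "complex_of_real (real (c k)) = of_real (real (c (Suc k)) + x (Suc k))"
    by (simp add: algebra_simps)
  then have "real (c k) = real (c (Suc k)) + x (Suc k)" by (simp only: of_real_eq_iff)
  moreover have "0 \<le> x (Suc k)" using x k by auto
  ultimately show "c (Suc k) \<le> c k" by simp
next
  assume decr: "\<forall>k. Suc k < n \<longrightarrow> c (Suc k) \<le> c k"
  show "dominant n (diag_functional n (\<lambda>k. of_nat (c k)))"
    unfolding dominant_def
  proof (intro exI[of _ "\<lambda>i. real (c (i - 1)) - real (c i)"] conjI ballI)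
    fix i assume "i \<in> {1..n - 1}"
    then show "0 \<le> real (c (i - 1)) - real (c i)" using decr[rule_format, of "i - 1"] by auto
  qed (simp add: fund_weight_differences[OF assms, of "\<lambda>k. of_nat (c k)", symmetric])
qed

section \<open>Weights of the spin module as score sequences\<close>

text \<open>Each game contributes half of the winner's \<epsilon> minus the loser's. A player's
  coefficient is half of wins minus losses, that is, the score minus \<open>(n - 1) / 2\<close>, and
  the constant disappears on traceless matrices.\<close>

lemma spin_weight_of_tournament:
  assumes T: "tournament n T"
  shows "spin_weight_of n {(i, j) \<in> positive_roots n. T j i} = diag_functional n (\<lambda>k. of_nat (score n T k))"
  unfolding spin_weight_of_def diag_functional_def
proof (rule restrict_ext)
  fix H assume H: "H \<in> cartan n"
  let ?P = "positive_roots n" and ?h = "\<lambda>k. H $$ (k, k)" and ?t = "\<lambda>i j. of_bool (T i j) :: complex"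
  let ?A = "{(i, j) \<in> ?P. T j i}" and ?s = "\<Sum>k<n. of_nat (score n T k) * ?h k"
  let ?F = "\<lambda>i j. ?t i j * (?h i - ?h j)"
  let ?G = "\<lambda>\<alpha>. ?F (fst \<alpha>) (snd \<alpha>) + ?F (snd \<alpha>) (fst \<alpha>)"
  \<comment> \<open>Exactly one of the two terms of \<open>?G\<close> survives, so \<open>?G\<close>
    is the root with the sign given by the winner.\<close>
  have G: "?G (i, j) = (if T j i then - root_functional n (i, j) H else root_functional n (i, j) H)"
    if "(i, j) \<in> ?P" for i j
    using that H tournament_flip[OF T, of i j] by (simp add: positive_roots_def root_functional_def eps_def)
  have "(\<Sum>\<alpha> \<in> ?P - ?A. root_functional n \<alpha> H) = sum ?G (?P - ?A)"
  proof (rule sum.cong)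
    fix \<alpha> assume "\<alpha> \<in> ?P - ?A"
    then show "root_functional n \<alpha> H = ?G \<alpha>" using G[of "fst \<alpha>" "snd \<alpha>"] by (cases \<alpha>) simp
  qed simp
  moreover have "- (\<Sum>\<alpha> \<in> ?A. root_functional n \<alpha> H) = sum ?G ?A"
    unfolding sum_negf[symmetric]
  proof (rule sum.cong)
    fix \<alpha> assume "\<alpha> \<in> ?A"
    then show "- root_functional n \<alpha> H = ?G \<alpha>" using G[of "fst \<alpha>" "snd \<alpha>"] by (cases \<alpha>) simp
  qed simp
  ultimately have "(\<Sum>\<alpha> \<in> ?P - ?A. root_functional n \<alpha> H) - (\<Sum>\<alpha> \<in> ?A. root_functional n \<alpha> H)
      = sum ?G (?P - ?A) + sum ?G ?A"
    by (simp only: diff_conv_add_uminus)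
  also have "\<dots> = (\<Sum>\<alpha> \<in> ?P. ?F (fst \<alpha>) (snd \<alpha>) + ?F (snd \<alpha>) (fst \<alpha>))"
    by (rule sum.subset_diff[symmetric]) auto
  also have "\<dots> = (\<Sum>i<n. \<Sum>j<n. ?F i j)"
    by (rule roots_sum) simp
  also have "\<dots> = (\<Sum>i<n. \<Sum>j<n. ?t i j * ?h i) - (\<Sum>i<n. \<Sum>j<n. ?t j i * ?h i)"
    by (subst (2) sum.swap) (simp add: sum_subtractf right_diff_distrib)
  \<comment> \<open>Losses are rewritten as the \<open>n - 1\<close> games played minus the wins;
    the games then contribute a multiple of the trace, which is 0.\<close>
  also have "(\<Sum>i<n. \<Sum>j<n. ?t j i * ?h i) = (\<Sum>i<n. \<Sum>j<n. ?h i - (if j = i then ?h i else 0) - ?t i j * ?h i)"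
  proof (intro sum.cong refl)
    fix i j assume "i \<in> {..<n}" "j \<in> {..<n}"
    then show "?t j i * ?h i = ?h i - (if j = i then ?h i else 0) - ?t i j * ?h i"
      using tournament_iff[OF T, of i j] tournament_irrefl[OF T, of i] by auto
  qed
  also have "\<dots> = - (\<Sum>i<n. \<Sum>j<n. ?t i j * ?h i)"
    by (simp add: sum_subtractf cartan_trace[OF H] flip: sum_distrib_left)
  also have "(\<Sum>i<n. \<Sum>j<n. ?t i j * ?h i) = ?s"
    by (simp add: score_eq_sum sum_distrib_right)
  finally show "1 / 2 * ((\<Sum>\<alpha> \<in> ?P - ?A. root_functional n \<alpha> H) - (\<Sum>\<alpha> \<in> ?A. root_functional n \<alpha> H)) = ?s"
    by simp
qed

lemma spin_weights_eq_scores: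
  "spin_weights n = (\<lambda>T. diag_functional n (\<lambda>k. of_nat (score n T k))) ` {T. tournament n T}"
proof (intro equalityI subsetI)
  fix \<xi> assume "\<xi> \<in> spin_weights n"
  then obtain A where A: "A \<subseteq> positive_roots n" "\<xi> = spin_weight_of n A"
    by (auto simp: spin_weights_eq)
  \<comment> \<open>The earlier player wins by default, and the pairs in \<open>A\<close> are the
    upsets. As \<open>A\<close> consists of positive roots, the second disjunct applies only when
    \<open>j < i\<close>.\<close>
  define T where "T i j \<longleftrightarrow> i < j \<and> (i, j) \<notin> A \<or> (j, i) \<in> A" for i j
  have T: "tournament n T"
    using A(1) by (auto simp: tournament_def T_def positive_roots_def)
  have "{(i, j) \<in> positive_roots n. T j i} = A"
    using A(1) by (auto simp: T_def positive_roots_def)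
  with A T spin_weight_of_tournament[OF T]
  show "\<xi> \<in> (\<lambda>T. diag_functional n (\<lambda>k. of_nat (score n T k))) ` {T. tournament n T}" by auto
next
  fix \<xi> assume "\<xi> \<in> (\<lambda>T. diag_functional n (\<lambda>k. of_nat (score n T k))) ` {T. tournament n T}"
  then obtain T where T: "tournament n T"
    and \<xi>: "\<xi> = spin_weight_of n {(i, j) \<in> positive_roots n. T j i}"
    by (auto simp: spin_weight_of_tournament)
  show "\<xi> \<in> spin_weights n" unfolding \<xi> spin_weights_eq by (intro imageI) auto
qed

section \<open>Partitions as decreasing score sequences\<close>

lemma partitions_iff:
  "p \<in> partitions n \<longleftrightarrow> length p = n \<and> (\<forall>k. Suc k < n \<longrightarrow> p ! Suc k \<le> p ! k) \<and>
     (\<Sum>k<n. p ! k) = n choose 2 \<and> (\<forall>i\<le>n. (\<Sum>k<i. p ! k) \<le> (\<Sum>k<i. n - Suc k))"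
proof -
  have "sorted_wrt (\<ge>) p \<longleftrightarrow> (\<forall>k. Suc k < length p \<longrightarrow> p ! Suc k \<le> p ! k)"
    by (subst sorted_wrt_iff_nth_Suc_transp) (auto intro: transpI)
  moreover have "(\<forall>i\<in>{1..n}. (\<Sum>k = 1..i. p ! (k - 1)) \<le> (\<Sum>k = 1..i. n - k))
    \<longleftrightarrow> (\<forall>i\<le>n. (\<Sum>k<i. p ! k) \<le> (\<Sum>k<i. n - Suc k))"
  proof -
    have "(\<Sum>k = 1..i. p ! (k - 1)) = (\<Sum>k<i. p ! k)" "(\<Sum>k = 1..i. n - k) = (\<Sum>k<i. n - Suc k)" for i
      by (simp_all add: sum.atLeast1_atMost_eq)
    \<comment> \<open>The bound added for \<open>i = 0\<close> compares two empty sums.\<close>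
    moreover have "i \<in> {1..n} \<or> i = 0" if "i \<le> n" for i using that by auto
    ultimately show ?thesis by fastforce
  qed
  ultimately show ?thesis
    by (auto simp: partitions_def sum_list_sum_nth atLeast0LessThan)
qed

theorem proposition4p5:
  fixes n :: nat
  assumes "1 \<le> n"
  shows "bij_betw (partition_weight n) (partitions n) (dominant_spin_weights n)"
proof (rule bij_betw_imageI)
  show "inj_on (partition_weight n) (partitions n)"
  proof (rule inj_onI)
    fix p q assume p: "p \<in> partitions n" and q: "q \<in> partitions n"
      and eq: "partition_weight n p = partition_weight n q"
    \<comment> \<open>Equal weights leave a common shift between the entries of \<open>p\<close> and
      \<open>q\<close>; integers allow it to have either sign. Since both totals are
      \<open>n choose 2\<close>, \<open>n\<close> times the shift is 0.\<close>
    have diff: "int (p ! k) - int (q ! k) = int (p ! 0) - int (q ! 0)" if "k < n" for k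
    proof -
      have "complex_of_nat (p ! k) - of_nat (q ! k) = of_nat (p ! 0) - of_nat (q ! 0)"
        by (rule eq[unfolded partition_weight_eq[OF assms] diag_functional_eq_iff, rule_format])
          (use that assms in auto)
      then have "complex_of_int (int (p ! k) - int (q ! k)) = of_int (int (p ! 0) - int (q ! 0))"
        by simp
      then show ?thesis by (simp only: of_int_eq_iff)
    qed
    have "int n * (int (p ! 0) - int (q ! 0)) = (\<Sum>k<n. int (p ! 0) - int (q ! 0))" by simp
    also have "\<dots> = (\<Sum>k<n. int (p ! k) - int (q ! k))"
      by (intro sum.cong refl diff[symmetric]) simp
    also have "\<dots> = int (\<Sum>k<n. p ! k) - int (\<Sum>k<n. q ! k)" by (simp add: sum_subtractf)
    also have "\<dots> = 0" using p q by (simp add: partitions_iff)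
    finally have "p ! k = q ! k" if "k < n" for k using diff[OF that] assms by simp
    then show "p = q" using p q by (intro nth_equalityI) (auto simp: partitions_iff)
  qed
  show "partition_weight n ` partitions n = dominant_spin_weights n"
  proof (intro equalityI subsetI)
    fix \<xi> assume "\<xi> \<in> partition_weight n ` partitions n"
    then obtain p where p: "p \<in> partitions n" and \<xi>: "\<xi> = diag_functional n (\<lambda>k. of_nat (p ! k))"
      by (auto simp: partition_weight_eq[OF assms])
    have "sorted_wrt (\<ge>) p" "length p = n" using p by (auto simp: partitions_def)
    then have decr: "p ! j \<le> p ! i" if "i \<le> j" "j < n" for i j
      using that sorted_wrt_nth_less[of "(\<ge>)" p i j] by (cases "i = j") auto
    have "\<exists>T. tournament n T \<and> (\<forall>k<n. score n T k = p ! k)"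
    proof (rule exists_tournament_dominated_score[OF decr tournament_less])
      show "(\<Sum>k<n. p ! k) = (\<Sum>k<n. score n (<) k)"
        using p by (simp add: partitions_iff score_sum[OF tournament_less])
      show "(\<Sum>k<i. p ! k) \<le> (\<Sum>k<i. score n (<) k)" if "i \<le> n" for i
        using p that by (simp add: partitions_iff score_less)
    qed
    then obtain T where T: "tournament n T" "\<forall>k<n. score n T k = p ! k" by blast
    then have "\<xi> = diag_functional n (\<lambda>k. of_nat (score n T k))"
      unfolding \<xi> diag_functional_eq_iff by simp
    with T have "\<xi> \<in> spin_weights n" unfolding spin_weights_eq_scores by blast
    moreover have "dominant n \<xi>"
      unfolding \<xi> dominant_diag_functional_iff[OF assms] using p by (simp add: partitions_iff)
    ultimately show "\<xi> \<in> dominant_spin_weights n" by (simp add: dominant_spin_weights_def)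
  next
    fix \<xi> assume "\<xi> \<in> dominant_spin_weights n"
    then obtain T where T: "tournament n T" and \<xi>: "\<xi> = diag_functional n (\<lambda>k. of_nat (score n T k))"
      and dom: "dominant n \<xi>"
      by (auto simp: dominant_spin_weights_def spin_weights_eq_scores)
    \<comment> \<open>Dominance puts the scores in weakly decreasing order, and the counting results
      give the total and the bounds.\<close>
    let ?p = "map (score n T) [0..<n]"
    have "?p \<in> partitions n"
      using dom score_partial_sum[OF T] score_sum[OF T]
      unfolding \<xi> dominant_diag_functional_iff[OF assms] partitions_iff by simp
    moreover have "\<xi> = partition_weight n ?p"
      unfolding \<xi> partition_weight_eq[OF assms] diag_functional_eq_iff by simp
    ultimately show "\<xi> \<in> partition_weight n ` partitions n" by blast
  qed
qed

end
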